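(* Let $(X_i)_{i\in\mathbb{N}}$ be an i.i.d. sequence of centered (real-valued) random variables with $$\mathbb{E}[|X_1|^{2q}]<\infty\qquad\text{for some }q\in\mathbb{N},\ q\geqslant1.$$ Then $$\lim_{n\to\infty}\frac1n\sum_{i=1}^nX_i=0\qquad\text{almost surely},$$ with polynomial mean deviation frequency in the following sense: for any $\varepsilon>0$, with $\mathcal{O}_\varepsilon:=\sum_{n=1}^\infty\mathbf{1}\{|\frac1n\sum_{i=1}^nX_i|\geqslant\varepsilon\}$, and any $0<p<q-1$ there is a constant $K_{\varepsilon,p}>0$ such that $$\mathbb{E}[\mathcal{O}_\varepsilon^{p}]<p\,K_{\varepsilon,p},\qquad\text{and in particular}\qquad \mathbb{P}(\mathcal{O}_\varepsilon\geqslant k)\leqslant p\,K_{\varepsilon,p}\cdot k^{-p}\quad\text{for all }k\in\mathbb{N}.$$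
   Context: $\mathbb{N}=\{1,2,\dots\}$. *)

theory Defs
  imports "HOL-Probability.Probability"
begin

(* Sequences are indexed by {1,2,...}; the value of X at 0 is never used. *)

definition iid_sequence :: "'a measure \<Rightarrow> (nat \<Rightarrow> 'a \<Rightarrow> real) \<Rightarrow> bool" where
  "iid_sequence M X \<longleftrightarrow>
     prob_space.indep_vars M (\<lambda>_. borel) X {1..} \<and>
     (\<forall>i\<ge>1. distr M borel (X i) = distr M borel (X 1))"

(* Integrability is part of being centered: the Bochner integral of a
   non-integrable function is 0 by convention. *)
definition centered :: "'a measure \<Rightarrow> ('a \<Rightarrow> real) \<Rightarrow> bool" where
  "centered M Y \<longleftrightarrow> integrable M Y \<and> integral\<^sup>L M Y = 0"

definition sample_mean :: "(nat \<Rightarrow> 'a \<Rightarrow> real) \<Rightarrow> nat \<Rightarrow> 'a \<Rightarrow> real" where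
  "sample_mean X n \<omega> = (\<Sum>i=1..n. X i \<omega>) / real n"

(* The count may be infinite, hence ennreal; n ranges over {1,2,...} via Suc. *)
definition deviation_count :: "(nat \<Rightarrow> 'a \<Rightarrow> real) \<Rightarrow> real \<Rightarrow> 'a \<Rightarrow> ennreal" where
  "deviation_count X \<epsilon> \<omega> =
     (\<Sum>n. indicator {\<omega>'. \<bar>sample_mean X (Suc n) \<omega>'\<bar> \<ge> \<epsilon>} \<omega>)"

(* Real powers of extended nonnegative reals, with \<infinity> raised to p equal to \<infinity>;
   meant for exponents p > 0. *)
definition ennreal_powr :: "ennreal \<Rightarrow> real \<Rightarrow> ennreal" where
  "ennreal_powr x p = (if x = \<infinity> then \<infinity> else ennreal (enn2real x powr p))"

end

theory Submission
  imports Defs "HOL-Library.Discrete_Functions"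
begin

text \<open>
  Write \<open>S\<^sub>n = X\<^sub>1 + \<dots> + X\<^sub>n\<close>. Everything rests on the growth of the moments of \<open>S\<^sub>n\<close>:
  since the summands are independent and centered, \<open>E S\<^sub>n\<^sup>r\<close> is of order at most
  \<open>n\<close> to the power \<open>r div 2\<close> (lemma \<open>moment_bound_indep_sum\<close>).

  For the deviation frequency, Markov's inequality for the moment of order \<open>2q\<close> gives
  \<open>P(|S\<^sub>n / n| \<ge> \<epsilon>) \<le> D n powr (-q)\<close>. The count \<open>O\<close> is at most the last index at which a
  deviation occurs, so \<open>O powr p\<close> is at most the sum of \<open>n powr p\<close> over all deviating
  indices \<open>n\<close> (lemma \<open>ennreal_powr_count_le_weighted_count\<close>). The expectation of this sum is at
  most the sum of \<open>D n powr (p - q)\<close> over all \<open>n \<ge> 1\<close>, which converges exactly because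
  \<open>p < q - 1\<close>. Any \<open>K\<close> with \<open>p K > E[O powr p]\<close> then serves, and Markov's inequality gives the
  tail bound.

  For \<open>q = 1\<close> the bounds \<open>P(|S\<^sub>n / n| \<ge> \<epsilon>) \<le> D / n\<close> are not summable, so the almost sure
  convergence cannot be read off from them. It is derived from second moments alone: the
  squared means along the square numbers, together with the squared fluctuations between
  consecutive squares, have summable expectations (lemma \<open>strong_law_of_quadratic_bound\<close>).
\<close>

section \<open>Moments of sums of independent centered variables\<close>

lemma (in prob_space) independent_sum_power:
  fixes Y S :: "'a \<Rightarrow> real"
  assumes indep: "indep_var borel Y borel S"
    and Y: "\<And>k. k \<le> r \<Longrightarrow> integrable M (\<lambda>\<omega>. Y \<omega> ^ k)"
    and S: "\<And>k. k \<le> r \<Longrightarrow> integrable M (\<lambda>\<omega>. S \<omega> ^ k)"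
  shows "integrable M (\<lambda>\<omega>. (Y \<omega> + S \<omega>) ^ r)"
    and "expectation (\<lambda>\<omega>. (Y \<omega> + S \<omega>) ^ r) =
      (\<Sum>k\<le>r. real (r choose k) * (expectation (\<lambda>\<omega>. Y \<omega> ^ k) * expectation (\<lambda>\<omega>. S \<omega> ^ (r - k))))"
proof -
  have ind: "indep_var borel (\<lambda>\<omega>. Y \<omega> ^ k) borel (\<lambda>\<omega>. S \<omega> ^ l)" for k l
    using indep_var_compose[OF indep, of "\<lambda>x. x ^ k" borel "\<lambda>x. x ^ l" borel]
    by (simp add: comp_def)
  have int: "integrable M (\<lambda>\<omega>. Y \<omega> ^ k * S \<omega> ^ (r - k))" if "k \<le> r" for k
    using that by (intro indep_var_integrable ind Y S) auto
  have eq: "(Y \<omega> + S \<omega>) ^ r = (\<Sum>k\<le>r. real (r choose k) * (Y \<omega> ^ k * S \<omega> ^ (r - k)))" for \<omega>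
    by (simp add: binomial_ring mult.assoc)
  show "integrable M (\<lambda>\<omega>. (Y \<omega> + S \<omega>) ^ r)"
    unfolding eq by (intro Bochner_Integration.integrable_sum integrable_mult_right int) auto
  have "expectation (\<lambda>\<omega>. (Y \<omega> + S \<omega>) ^ r) =
      (\<Sum>k\<le>r. real (r choose k) * expectation (\<lambda>\<omega>. Y \<omega> ^ k * S \<omega> ^ (r - k)))"
    unfolding eq
    by (subst Bochner_Integration.integral_sum) (auto intro!: integrable_mult_right int)
  also have "\<dots> = (\<Sum>k\<le>r. real (r choose k) * (expectation (\<lambda>\<omega>. Y \<omega> ^ k) * expectation (\<lambda>\<omega>. S \<omega> ^ (r - k))))"
  proof (intro sum.cong refl)
    fix k assume "k \<in> {..r}"
    then show "real (r choose k) * expectation (\<lambda>\<omega>. Y \<omega> ^ k * S \<omega> ^ (r - k)) =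
      real (r choose k) * (expectation (\<lambda>\<omega>. Y \<omega> ^ k) * expectation (\<lambda>\<omega>. S \<omega> ^ (r - k)))"
      by (subst indep_var_lebesgue_integral[OF ind]) (auto intro!: Y S)
  qed
  finally show "expectation (\<lambda>\<omega>. (Y \<omega> + S \<omega>) ^ r) =
      (\<Sum>k\<le>r. real (r choose k) * (expectation (\<lambda>\<omega>. Y \<omega> ^ k) * expectation (\<lambda>\<omega>. S \<omega> ^ (r - k))))" .
qed

lemma (in prob_space) integrable_power_indep_sum:
  fixes X :: "'i \<Rightarrow> 'a \<Rightarrow> real"
  assumes indep: "indep_vars (\<lambda>_. borel) X J"
    and int: "\<And>i k. i \<in> J \<Longrightarrow> k \<le> R \<Longrightarrow> integrable M (\<lambda>\<omega>. X i \<omega> ^ k)"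
    and "finite I" "I \<subseteq> J" "r \<le> R"
  shows "integrable M (\<lambda>\<omega>. (\<Sum>i\<in>I. X i \<omega>) ^ r)"
  using \<open>finite I\<close> \<open>I \<subseteq> J\<close> \<open>r \<le> R\<close>
proof (induction I arbitrary: r)
  case empty
  then show ?case by simp
next
  case (insert i I)
  have "indep_var borel (X i) borel (\<lambda>\<omega>. \<Sum>i\<in>I. X i \<omega>)"
    using insert by (intro indep_vars_sum indep_vars_subset[OF indep]) auto
  then have "integrable M (\<lambda>\<omega>. (X i \<omega> + (\<Sum>i\<in>I. X i \<omega>)) ^ r)"
    using insert by (intro independent_sum_power(1) int) auto
  then show ?case using insert by simp
qed

text \<open>
  Signed moments are used because they obey a closed recursion. Adding one more summand \<open>X\<close> to
  \<open>S\<close> changes \<open>E (S ^ r)\<close> by binomial multiples of \<open>E (X ^ k) * E (S ^ (r - k))\<close> with \<open>k \<ge> 1\<close>; the term \<open>k = 1\<close>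
  vanishes because \<open>X\<close> is centered, and for \<open>k \<ge> 2\<close> the moment of \<open>S\<close> has order at most \<open>r - 2\<close>,
  hence grows with an exponent at most \<open>r div 2 - 1\<close>. Summing these increments over the
  summands raises the exponent by one. The constant is uniform in \<open>I\<close>, so that the bound also
  applies to sums over blocks of indices.
\<close>
lemma (in prob_space) moment_bound_indep_sum:
  fixes X :: "'i \<Rightarrow> 'a \<Rightarrow> real"
  assumes indep: "indep_vars (\<lambda>_. borel) X J"
    and int: "\<And>i k. i \<in> J \<Longrightarrow> k \<le> R \<Longrightarrow> integrable M (\<lambda>\<omega>. X i \<omega> ^ k)"
    and mean: "\<And>i. i \<in> J \<Longrightarrow> expectation (X i) = 0"
    and bound: "\<And>i k. i \<in> J \<Longrightarrow> k \<le> R \<Longrightarrow> \<bar>expectation (\<lambda>\<omega>. X i \<omega> ^ k)\<bar> \<le> B"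
    and "0 \<le> B" "r \<le> R"
  shows "\<exists>C\<ge>0. \<forall>I. finite I \<longrightarrow> I \<subseteq> J \<longrightarrow>
    \<bar>expectation (\<lambda>\<omega>. (\<Sum>i\<in>I. X i \<omega>) ^ r)\<bar> \<le> C * real (card I) ^ (r div 2)"
  using \<open>r \<le> R\<close>
proof (induction r rule: less_induct)
  case (less r)
  have intS: "integrable M (\<lambda>\<omega>. (\<Sum>i\<in>I. X i \<omega>) ^ k)" if "finite I" "I \<subseteq> J" "k \<le> r" for I k
    using that less.prems by (intro integrable_power_indep_sum[OF indep int]) auto
  consider "r = 0" | "r = 1" | "r \<ge> 2" by linarith
  then show ?case
  proof cases
    case 1
    then show ?thesis by (intro exI[of _ 1]) (simp add: prob_space)
  next
    case 2
    have "expectation (\<lambda>\<omega>. \<Sum>i\<in>I. X i \<omega>) = 0" if "finite I" "I \<subseteq> J" for I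
      using that less.prems 2 mean int[of _ 1]
      by (subst Bochner_Integration.integral_sum) (auto intro!: sum.neutral)
    then show ?thesis using 2 by (intro exI[of _ 0]) simp
  next
    case 3
    have "\<forall>m\<in>{..<r}. \<exists>C\<ge>0. \<forall>I. finite I \<longrightarrow> I \<subseteq> J \<longrightarrow>
        \<bar>expectation (\<lambda>\<omega>. (\<Sum>i\<in>I. X i \<omega>) ^ m)\<bar> \<le> C * real (card I) ^ (m div 2)"
      using less by auto
    from bchoice[OF this] obtain C where C: "\<And>m. m < r \<Longrightarrow> C m \<ge> 0"
      "\<And>m I. m < r \<Longrightarrow> finite I \<Longrightarrow> I \<subseteq> J \<Longrightarrow>
        \<bar>expectation (\<lambda>\<omega>. (\<Sum>i\<in>I. X i \<omega>) ^ m)\<bar> \<le> C m * real (card I) ^ (m div 2)"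
      by (auto simp: lessThan_iff)
    \<comment> \<open>\<open>D\<close> times a power of \<open>card I + 1\<close> bounds the increment caused by one new summand.\<close>
    define D where "D = (\<Sum>k\<in>{2..r}. real (r choose k) * (B * C (r - k)))"
    have D: "D \<ge> 0" unfolding D_def using C(1) \<open>0 \<le> B\<close> 3
      by (intro sum_nonneg mult_nonneg_nonneg) auto
    define h where "h = r div 2 - 1"
    have h: "r div 2 = Suc h" using 3 unfolding h_def by auto
    have "\<bar>expectation (\<lambda>\<omega>. (\<Sum>i\<in>I. X i \<omega>) ^ r)\<bar> \<le> D * real (card I) ^ Suc h"
      if "finite I" "I \<subseteq> J" for I
      using that
    proof (induction I)
      case empty
      then show ?case using 3 D by (simp add: power_0_left)
    next
      case (insert i I)
      define n where "n = card I"
      define S where "S = (\<lambda>\<omega>. \<Sum>i\<in>I. X i \<omega>)"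
      define f where "f k = real (r choose k) *
          (expectation (\<lambda>\<omega>. X i \<omega> ^ k) * expectation (\<lambda>\<omega>. S \<omega> ^ (r - k)))" for k
      have "indep_var borel (X i) borel S" unfolding S_def
        using insert by (intro indep_vars_sum indep_vars_subset[OF indep]) auto
      then have "expectation (\<lambda>\<omega>. (X i \<omega> + S \<omega>) ^ r) = (\<Sum>k\<le>r. f k)"
        unfolding f_def using insert less.prems
        by (intro independent_sum_power(2) int) (auto simp: S_def intro!: intS)
      also have "{..r} = insert 0 (insert 1 {2..r})" using 3 by auto
      also have "(\<Sum>k\<in>insert 0 (insert 1 {2..r}). f k) = f 0 + (f 1 + (\<Sum>k\<in>{2..r}. f k))"
        by simp
      also have "f 0 = expectation (\<lambda>\<omega>. S \<omega> ^ r)" by (simp add: f_def prob_space)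
      also have "f 1 = 0" using insert mean[of i] by (simp add: f_def)
      finally have eq: "expectation (\<lambda>\<omega>. (X i \<omega> + S \<omega>) ^ r) =
        expectation (\<lambda>\<omega>. S \<omega> ^ r) + (\<Sum>k\<in>{2..r}. f k)" by simp
      have "\<bar>f k\<bar> \<le> real (r choose k) * (B * C (r - k)) * real (Suc n) ^ h" if k: "k \<in> {2..r}" for k
      proof -
        have "\<bar>expectation (\<lambda>\<omega>. S \<omega> ^ (r - k))\<bar> \<le> C (r - k) * real n ^ ((r - k) div 2)"
          unfolding S_def n_def using k insert 3 by (intro C(2)) auto
        \<comment> \<open>Passing to \<open>Suc n\<close> matters for \<open>n = 0\<close>: powers of \<open>0\<close> do not increase with the exponent.\<close>
        also have "real n ^ ((r - k) div 2) \<le> real (Suc n) ^ ((r - k) div 2)"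
          by (intro power_mono) auto
        also have "\<dots> \<le> real (Suc n) ^ h"
        proof (intro power_increasing)
          have "(r - k) div 2 \<le> (r - 2) div 2" using k by (intro div_le_mono) auto
          then show "(r - k) div 2 \<le> h" using 3 unfolding h_def by auto
        qed auto
        finally have 1: "\<bar>expectation (\<lambda>\<omega>. S \<omega> ^ (r - k))\<bar> \<le> C (r - k) * real (Suc n) ^ h"
          using C(1)[of "r - k"] k 3 by (auto simp: mult_left_mono)
        have "\<bar>expectation (\<lambda>\<omega>. X i \<omega> ^ k)\<bar> \<le> B"
          using bound k insert less.prems by auto
        from mult_mono[OF this 1 \<open>0 \<le> B\<close>]
        have "\<bar>expectation (\<lambda>\<omega>. X i \<omega> ^ k) * expectation (\<lambda>\<omega>. S \<omega> ^ (r - k))\<bar>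
          \<le> B * (C (r - k) * real (Suc n) ^ h)" by (simp add: abs_mult)
        then have "real (r choose k) * \<bar>expectation (\<lambda>\<omega>. X i \<omega> ^ k) * expectation (\<lambda>\<omega>. S \<omega> ^ (r - k))\<bar>
          \<le> real (r choose k) * (B * (C (r - k) * real (Suc n) ^ h))"
          by (intro mult_left_mono) auto
        then show ?thesis unfolding f_def by (simp add: abs_mult mult.assoc)
      qed
      then have "(\<Sum>k\<in>{2..r}. \<bar>f k\<bar>) \<le> D * real (Suc n) ^ h"
        unfolding D_def sum_distrib_right by (intro sum_mono) auto
      then have f: "\<bar>\<Sum>k\<in>{2..r}. f k\<bar> \<le> D * real (Suc n) ^ h"
        using sum_abs[of f "{2..r}"] by linarith
      have "\<bar>expectation (\<lambda>\<omega>. S \<omega> ^ r)\<bar> \<le> D * real n ^ Suc h"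
        unfolding S_def n_def using insert by auto
      with f eq have "\<bar>expectation (\<lambda>\<omega>. (X i \<omega> + S \<omega>) ^ r)\<bar> \<le> D * (real n ^ Suc h + real (Suc n) ^ h)"
        by (simp add: distrib_left)
      also have "real n ^ Suc h \<le> real n * real (Suc n) ^ h"
        by (auto intro!: mult_left_mono power_mono)
      then have "D * (real n ^ Suc h + real (Suc n) ^ h) \<le> D * real (Suc n) ^ Suc h"
        using D by (intro mult_left_mono) (auto simp: algebra_simps)
      finally show ?case using insert by (simp add: S_def n_def)
    qed
    then show ?thesis using D h by auto
  qed
qed

section \<open>The strong law from second moments\<close>

lemma AE_tendsto_0_of_summable_integrals:
  fixes f :: "nat \<Rightarrow> 'a \<Rightarrow> real"
  assumes int: "\<And>n. integrable M (f n)" and nonneg: "\<And>n x. 0 \<le> f n x"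
    and sum: "summable (\<lambda>n. integral\<^sup>L M (f n))"
  shows "AE x in M. (\<lambda>n. f n x) \<longlonglongrightarrow> 0"
proof -
  have [measurable]: "f n \<in> borel_measurable M" for n
    using int by auto
  have "(\<integral>\<^sup>+x. (\<Sum>n. ennreal (f n x)) \<partial>M) = (\<Sum>n. \<integral>\<^sup>+x. ennreal (f n x) \<partial>M)"
    by (intro nn_integral_suminf) auto
  also have "\<dots> = (\<Sum>n. ennreal (integral\<^sup>L M (f n)))"
    by (intro suminf_cong nn_integral_eq_integral int) (simp add: nonneg)
  also have "\<dots> = ennreal (\<Sum>n. integral\<^sup>L M (f n))"
    by (intro suminf_ennreal2 sum) (simp add: nonneg)
  finally have "(\<integral>\<^sup>+x. (\<Sum>n. ennreal (f n x)) \<partial>M) \<noteq> \<infinity>" by simp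
  then have "AE x in M. (\<Sum>n. ennreal (f n x)) \<noteq> \<infinity>"
    by (intro nn_integral_PInf_AE) auto
  then show ?thesis
    by (rule AE_mp) (auto intro!: AE_I2 summable_LIMSEQ_zero summable_suminf_not_top nonneg)
qed

text \<open>
  Each index \<open>m\<close> lies in the block between two consecutive squares that starts at
  \<open>n\<^sup>2 \<le> m\<close>. Bounding the one increment \<open>s m - s (n\<^sup>2)\<close> by the sum over the whole block replaces
  a maximal inequality, which the short length \<open>2n + 1\<close> of the block makes affordable.
\<close>
lemma power2_mean_le_block:
  fixes s :: "nat \<Rightarrow> real"
  assumes "1 \<le> m"
  defines "n \<equiv> floor_sqrt m"
  shows "(s m / real m)\<^sup>2 \<le>
    2 * ((s (n\<^sup>2))\<^sup>2 + (\<Sum>j\<in>{n\<^sup>2..<(Suc n)\<^sup>2}. (s j - s (n\<^sup>2))\<^sup>2)) / real n ^ 4"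
proof -
  define V where "V = (\<Sum>j\<in>{n\<^sup>2..<(Suc n)\<^sup>2}. (s j - s (n\<^sup>2))\<^sup>2)"
  have n: "n\<^sup>2 \<le> m" "m < (Suc n)\<^sup>2" "n \<ge> 1"
    using assms Suc_floor_sqrt_power2_gt[of m] by (auto simp: n_def Suc_le_eq)
  have "(s m - s (n\<^sup>2))\<^sup>2 \<le> V" unfolding V_def
    using n by (intro member_le_sum) auto
  \<comment> \<open>\<open>(a + b)\<^sup>2 \<le> 2 a\<^sup>2 + 2 b\<^sup>2\<close>, with difference \<open>(a - b)\<^sup>2\<close>.\<close>
  moreover have "(s m)\<^sup>2 \<le> 2 * (s (n\<^sup>2))\<^sup>2 + 2 * (s m - s (n\<^sup>2))\<^sup>2"
    using sum_squares_ge_zero[of "s m - 2 * s (n\<^sup>2)" 0] by (simp add: power2_eq_square algebra_simps)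
  ultimately have "(s m)\<^sup>2 \<le> 2 * ((s (n\<^sup>2))\<^sup>2 + V)" by simp
  moreover have "real n ^ 4 \<le> (real m)\<^sup>2"
  proof -
    have "real (n\<^sup>2) \<le> real m" using n by simp
    then have "(real (n\<^sup>2))\<^sup>2 \<le> (real m)\<^sup>2" by (intro power_mono) auto
    then show ?thesis by (simp flip: power_mult)
  qed
  moreover have "V \<ge> 0" unfolding V_def by (intro sum_nonneg) auto
  ultimately have "(s m)\<^sup>2 / (real m)\<^sup>2 \<le> 2 * ((s (n\<^sup>2))\<^sup>2 + V) / real n ^ 4"
    using n by (intro frac_le) auto
  then show ?thesis by (simp add: V_def power_divide)
qed

text \<open>
  The block starting at \<open>n\<^sup>2\<close> contributes at most \<open>C n\<^sup>2\<close> from its first partial sum and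
  \<open>2n + 1\<close> increments of second moment at most \<open>2 C n\<close>; after division by \<open>n^4\<close> the total is of
  order \<open>1 / n\<^sup>2\<close> and hence summable, so the block quantities tend to \<open>0\<close> almost surely.
\<close>
lemma (in prob_space) strong_law_of_quadratic_bound:
  fixes X :: "nat \<Rightarrow> 'a \<Rightarrow> real"
  assumes int: "\<And>I. finite I \<Longrightarrow> I \<subseteq> {1..} \<Longrightarrow> integrable M (\<lambda>\<omega>. (\<Sum>i\<in>I. X i \<omega>)\<^sup>2)"
    and bound: "\<And>I. finite I \<Longrightarrow> I \<subseteq> {1..} \<Longrightarrow>
      expectation (\<lambda>\<omega>. (\<Sum>i\<in>I. X i \<omega>)\<^sup>2) \<le> C * real (card I)"
    and C: "0 \<le> C"
  shows "AE \<omega> in M. (\<lambda>n. sample_mean X n \<omega>) \<longlonglongrightarrow> 0"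
proof -
  define S where "S n \<omega> = (\<Sum>i=1..n. X i \<omega>)" for n \<omega>
  define Z where "Z n \<omega> = ((S (n\<^sup>2) \<omega>)\<^sup>2 +
    (\<Sum>j\<in>{n\<^sup>2..<(Suc n)\<^sup>2}. (S j \<omega> - S (n\<^sup>2) \<omega>)\<^sup>2)) / real n ^ 4" for n \<omega>
  have diff: "S j \<omega> - S k \<omega> = (\<Sum>i\<in>{k<..j}. X i \<omega>)" if "k \<le> j" for j k \<omega>
  proof -
    have "{1..j} = {1..k} \<union> {k<..j}" using that by auto
    then have "S j \<omega> = S k \<omega> + (\<Sum>i\<in>{k<..j}. X i \<omega>)"
      unfolding S_def by (simp, subst sum.union_disjoint) auto
    then show ?thesis by simp
  qed
  have int_diff: "integrable M (\<lambda>\<omega>. (S j \<omega> - S k \<omega>)\<^sup>2)" if "k \<le> j" for j k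
    using that by (auto simp: diff intro!: int)
  have int_S: "integrable M (\<lambda>\<omega>. (S j \<omega>)\<^sup>2)" for j
    unfolding S_def by (intro int) auto
  have intZ: "integrable M (Z n)" for n
    unfolding Z_def
    by (intro integrable_divide Bochner_Integration.integrable_add int_S
        Bochner_Integration.integrable_sum int_diff) auto
  have nonneg: "0 \<le> Z n \<omega>" for n \<omega>
    unfolding Z_def by (intro divide_nonneg_nonneg add_nonneg_nonneg sum_nonneg) auto
  have EZ: "norm (expectation (Z n)) \<le> 10 * C * (1 / real n ^ 2)" if "n \<ge> 1" for n
  proof -
    have "expectation (Z n) = (expectation (\<lambda>\<omega>. (S (n\<^sup>2) \<omega>)\<^sup>2) +
      (\<Sum>j\<in>{n\<^sup>2..<(Suc n)\<^sup>2}. expectation (\<lambda>\<omega>. (S j \<omega> - S (n\<^sup>2) \<omega>)\<^sup>2))) / real n ^ 4"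
      unfolding Z_def
      by (subst integral_divide_zero, subst Bochner_Integration.integral_add,
          (intro int_S Bochner_Integration.integrable_sum int_diff; simp)+,
          subst Bochner_Integration.integral_sum, auto intro!: int_diff)
    also have "\<dots> \<le> (C * real (n\<^sup>2) + (\<Sum>j\<in>{n\<^sup>2..<(Suc n)\<^sup>2}. C * (2 * real n))) / real n ^ 4"
    proof (intro divide_right_mono add_mono sum_mono)
      show "expectation (\<lambda>\<omega>. (S (n\<^sup>2) \<omega>)\<^sup>2) \<le> C * real (n\<^sup>2)"
        unfolding S_def using bound[of "{1..n\<^sup>2}"] by simp
      fix j assume j: "j \<in> {n\<^sup>2..<(Suc n)\<^sup>2}"
      then have "expectation (\<lambda>\<omega>. (S j \<omega> - S (n\<^sup>2) \<omega>)\<^sup>2) \<le> C * real (j - n\<^sup>2)"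
        using bound[of "{n\<^sup>2<..j}"] by (force simp: diff)
      also have "\<dots> \<le> C * (2 * real n)"
      proof -
        have "j - n\<^sup>2 \<le> 2 * n" using j by (auto simp: power2_eq_square)
        then have "real (j - n\<^sup>2) \<le> 2 * real n" by linarith
        then show ?thesis using C by (intro mult_left_mono)
      qed
      finally show "expectation (\<lambda>\<omega>. (S j \<omega> - S (n\<^sup>2) \<omega>)\<^sup>2) \<le> C * (2 * real n)" .
    qed auto
    also have "\<dots> = C * ((real n)\<^sup>2 + (2 * real n + 1) * (2 * real n)) / real n ^ 4"
      by (simp add: power2_eq_square algebra_simps)
    also have "\<dots> \<le> C * (10 * (real n)\<^sup>2) / real n ^ 4"
    proof (intro divide_right_mono mult_left_mono C)
      have "real n \<le> real n * real n" using that by simp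
      then show "(real n)\<^sup>2 + (2 * real n + 1) * (2 * real n) \<le> 10 * (real n)\<^sup>2"
        by (simp add: power2_eq_square algebra_simps)
    qed auto
    also have "\<dots> = 10 * C * (1 / real n ^ 2)"
      using that by (simp add: field_simps power4_eq_xxxx power2_eq_square)
    finally show ?thesis by (simp add: nonneg)
  qed
  have "summable (\<lambda>n. 10 * C * (1 / real n ^ 2))"
    by (intro summable_mult) (simp add: inverse_power_summable divide_inverse)
  then have "summable (\<lambda>n. expectation (Z n))"
    by (rule summable_comparison_test[rotated]) (use EZ in auto)
  then have "AE \<omega> in M. (\<lambda>n. Z n \<omega>) \<longlonglongrightarrow> 0"
    by (intro AE_tendsto_0_of_summable_integrals intZ nonneg)
  moreover have "(\<lambda>n. sample_mean X n \<omega>) \<longlonglongrightarrow> 0" if "(\<lambda>n. Z n \<omega>) \<longlonglongrightarrow> 0" for \<omega>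
  proof -
    have "filterlim floor_sqrt at_top at_top"
      unfolding filterlim_at_top
      by (intro allI eventually_at_top_linorderI[where c = "_\<^sup>2"] le_floor_sqrtI)
    from filterlim_compose[OF that this]
    have upper: "(\<lambda>m. 2 * Z (floor_sqrt m) \<omega>) \<longlonglongrightarrow> 0"
      by (rule tendsto_mult_right_zero)
    have "\<forall>\<^sub>F m in sequentially. (S m \<omega> / real m)\<^sup>2 \<le> 2 * Z (floor_sqrt m) \<omega>"
      using power2_mean_le_block[of _ "\<lambda>j. S j \<omega>"]
      by (intro eventually_sequentiallyI[of 1]) (simp add: Z_def)
    from this tendsto_const upper have "(\<lambda>m. (S m \<omega> / real m)\<^sup>2) \<longlonglongrightarrow> 0"
      by (rule tendsto_sandwich[rotated]) simp
    then have "(\<lambda>m. S m \<omega> / real m) \<longlonglongrightarrow> 0"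
      using tendsto_real_sqrt[of "\<lambda>m. (S m \<omega> / real m)\<^sup>2" 0]
      by (simp only: real_sqrt_abs real_sqrt_zero tendsto_rabs_zero_iff)
    then show ?thesis by (simp add: sample_mean_def S_def)
  qed
  ultimately show ?thesis by (rule eventually_mono)
qed

section \<open>Moments of the deviation count\<close>

text \<open>
  If the right-hand side is finite, only finitely many events occur. The last of them, number
  \<open>N\<close>, contributes \<open>Suc N powr p\<close>, and no more than \<open>Suc N\<close> events can have occurred by then.
\<close>
lemma ennreal_powr_count_le_weighted_count:
  assumes "p > 0"
  shows "ennreal_powr (\<Sum>n. indicator (A n) \<omega>) p
    \<le> (\<Sum>n. ennreal (real (Suc n) powr p) * indicator (A n) \<omega>)" (is "_ \<le> ?W")
proof (cases "?W = \<infinity>")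
  case False
  define J where "J = {n. \<omega> \<in> A n}"
  have ind: "indicator (A n) \<omega> = ennreal (indicator J n)" for n
    by (simp add: J_def indicator_def)
  have "(\<Sum>n. ennreal (indicator J n)) \<le> ?W"
  proof (intro suminf_le)
    show "ennreal (indicator J n) \<le> ennreal (real (Suc n) powr p) * indicator (A n) \<omega>" for n
    proof (cases "n \<in> J")
      case True
      have "ennreal 1 \<le> ennreal (real (Suc n) powr p)"
        using assms by (intro ennreal_leI ge_one_powr_ge_zero) auto
      then show ?thesis using True by (simp add: J_def)
    qed (simp add: J_def)
  qed auto
  then have "summable (indicator J :: nat \<Rightarrow> real)"
    using False by (intro summable_suminf_not_top) (auto simp: top_unique)
  then have "(indicator J :: nat \<Rightarrow> real) \<longlonglongrightarrow> 0"
    by (rule summable_LIMSEQ_zero)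
  then have "\<forall>\<^sub>F n in sequentially. indicator J n < (1::real)"
    by (rule order_tendstoD) simp
  then have "\<forall>\<^sub>F n in cofinite. n \<notin> J"
    unfolding cofinite_eq_sequentially
    by (rule eventually_mono) (auto simp: indicator_def split: if_splits)
  then have fin: "finite J" by (simp add: eventually_cofinite)
  have "(\<Sum>n. ennreal (indicator J n)) = (\<Sum>n\<in>J. ennreal (indicator J n))"
    using fin by (intro suminf_finite) auto
  also have "\<dots> = ennreal (real (card J))"
    by (simp add: ennreal_of_nat_eq_real_of_nat)
  finally have count: "ennreal_powr (\<Sum>n. indicator (A n) \<omega>) p = ennreal (real (card J) powr p)"
    by (simp add: ind ennreal_powr_def)
  show ?thesis
  proof (cases "J = {}")
    case True
    then show ?thesis unfolding count by simp
  next
    case ne: False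
    define N where "N = Max J"
    have N: "N \<in> J" "J \<subseteq> {..N}" using fin ne by (auto simp: N_def)
    then have "card J \<le> Suc N" using card_mono[of "{..N}" J] by simp
    then have "ennreal (real (card J) powr p) \<le> ennreal (real (Suc N) powr p)"
      using assms by (intro ennreal_leI powr_mono2) auto
    also have "\<dots> = (\<Sum>n\<in>{N}. ennreal (real (Suc n) powr p) * indicator (A n) \<omega>)"
      using N by (simp add: J_def)
    also have "\<dots> \<le> ?W" by (intro sum_le_suminf) auto
    finally show ?thesis unfolding count .
  qed
qed auto

lemma (in prob_space) prob_large_sample_mean_le:
  fixes X :: "nat \<Rightarrow> 'a \<Rightarrow> real"
  assumes int: "integrable M (\<lambda>\<omega>. (\<Sum>i=1..n. X i \<omega>) ^ (2 * q))"
    and bound: "expectation (\<lambda>\<omega>. (\<Sum>i=1..n. X i \<omega>) ^ (2 * q)) \<le> C * real n ^ q"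
    and meas: "sample_mean X n \<in> borel_measurable M" and "n \<ge> 1" "\<epsilon> > 0"
  shows "prob {\<omega> \<in> space M. \<epsilon> \<le> \<bar>sample_mean X n \<omega>\<bar>} \<le> C / \<epsilon> ^ (2 * q) * real n powr (- real q)"
proof -
  define c where "c = (\<epsilon> * real n) ^ (2 * q)"
  have c: "c > 0" using assms by (simp add: c_def)
  have "prob {\<omega> \<in> space M. \<epsilon> \<le> \<bar>sample_mean X n \<omega>\<bar>}
      \<le> prob {\<omega> \<in> space M. c \<le> (\<Sum>i=1..n. X i \<omega>) ^ (2 * q)}"
  proof (rule finite_measure_mono)
    show "{\<omega> \<in> space M. \<epsilon> \<le> \<bar>sample_mean X n \<omega>\<bar>}
        \<subseteq> {\<omega> \<in> space M. c \<le> (\<Sum>i=1..n. X i \<omega>) ^ (2 * q)}"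
    proof clarify
      fix \<omega> assume "\<epsilon> \<le> \<bar>sample_mean X n \<omega>\<bar>"
      then have "\<epsilon> * real n \<le> \<bar>\<Sum>i=1..n. X i \<omega>\<bar>"
        using \<open>n \<ge> 1\<close> by (simp add: sample_mean_def field_simps)
      then have "(\<epsilon> * real n) ^ (2 * q) \<le> \<bar>\<Sum>i=1..n. X i \<omega>\<bar> ^ (2 * q)"
        using \<open>\<epsilon> > 0\<close> by (intro power_mono) auto
      then show "c \<le> (\<Sum>i=1..n. X i \<omega>) ^ (2 * q)" by (simp add: c_def power_even_abs)
    qed
    have [measurable]: "(\<lambda>\<omega>. (\<Sum>i=1..n. X i \<omega>) ^ (2 * q)) \<in> borel_measurable M"
      using int by auto
    show "{\<omega> \<in> space M. c \<le> (\<Sum>i=1..n. X i \<omega>) ^ (2 * q)} \<in> sets M" by measurable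
  qed
  also have "\<dots> \<le> expectation (\<lambda>\<omega>. (\<Sum>i=1..n. X i \<omega>) ^ (2 * q)) / c"
    by (rule integral_Markov_inequality_measure[OF int, of "{}"]) (auto simp: c zero_le_even_power)
  also have "\<dots> \<le> C * real n ^ q / c"
    using bound c by (intro divide_right_mono) auto
  also have "\<dots> = C / \<epsilon> ^ (2 * q) * (real n ^ q / real n ^ (2 * q))"
    by (simp add: c_def power_mult_distrib)
  also have "real n ^ q / real n ^ (2 * q) = real n powr (- real q)"
    using \<open>n \<ge> 1\<close> by (simp add: powr_minus powr_realpow mult_2 power_add divide_simps)
  finally show ?thesis .
qed

lemma (in prob_space) nn_integral_deviation_count_powr_finite:
  fixes X :: "nat \<Rightarrow> 'a \<Rightarrow> real"
  assumes meas: "\<And>n. sample_mean X n \<in> borel_measurable M"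
    and tail: "\<And>n. n \<ge> 1 \<Longrightarrow>
      prob {\<omega> \<in> space M. \<epsilon> \<le> \<bar>sample_mean X n \<omega>\<bar>} \<le> D * real n powr (- s)"
    and p: "0 < p" "p < s - 1"
  shows "(\<integral>\<^sup>+\<omega>. ennreal_powr (deviation_count X \<epsilon> \<omega>) p \<partial>M) < \<infinity>"
proof -
  note meas[measurable]
  define A where "A n = {\<omega>. \<epsilon> \<le> \<bar>sample_mean X (Suc n) \<omega>\<bar>}" for n
  define A' where "A' n = {\<omega> \<in> space M. \<epsilon> \<le> \<bar>sample_mean X (Suc n) \<omega>\<bar>}" for n
  have [measurable]: "A' n \<in> sets M" for n unfolding A'_def by measurable
  have "(\<integral>\<^sup>+\<omega>. ennreal_powr (deviation_count X \<epsilon> \<omega>) p \<partial>M)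
      \<le> (\<integral>\<^sup>+\<omega>. (\<Sum>n. ennreal (real (Suc n) powr p) * indicator (A n) \<omega>) \<partial>M)"
    unfolding deviation_count_def A_def
    by (intro nn_integral_mono ennreal_powr_count_le_weighted_count p)
  also have "\<dots> = (\<integral>\<^sup>+\<omega>. (\<Sum>n. ennreal (real (Suc n) powr p) * indicator (A' n) \<omega>) \<partial>M)"
    by (intro nn_integral_cong suminf_cong) (auto simp: A_def A'_def indicator_def)
  also have "\<dots> = (\<Sum>n. ennreal (real (Suc n) powr p) * emeasure M (A' n))"
    by (subst nn_integral_suminf) (auto simp: nn_integral_cmult_indicator)
  also have "\<dots> \<le> (\<Sum>n. ennreal (D * real (Suc n) powr (p - s)))"
  proof (intro suminf_le)
    fix n
    have "ennreal (real (Suc n) powr p) * emeasure M (A' n) = ennreal (real (Suc n) powr p * prob (A' n))"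
      by (simp add: emeasure_eq_measure ennreal_mult)
    also have "\<dots> \<le> ennreal (real (Suc n) powr p * (D * real (Suc n) powr (- s)))"
      unfolding A'_def by (intro ennreal_leI mult_left_mono tail) auto
    also have "real (Suc n) powr p * (D * real (Suc n) powr (- s)) = D * real (Suc n) powr (p - s)"
      using powr_add[of "real (Suc n)" p "- s"] by simp
    finally show "ennreal (real (Suc n) powr p) * emeasure M (A' n)
      \<le> ennreal (D * real (Suc n) powr (p - s))" .
  qed auto
  also have "\<dots> = ennreal (\<Sum>n. D * real (Suc n) powr (p - s))"
  proof (rule suminf_ennreal2)
    have "0 \<le> D" using tail[of 1] order_trans[OF measure_nonneg] by fastforce
    then show "0 \<le> D * real (Suc n) powr (p - s)" for n by simp
    have "summable (\<lambda>n. real n powr (p - s))"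
      using p by (subst summable_real_powr_iff) auto
    then show "summable (\<lambda>n. D * real (Suc n) powr (p - s))"
      by (intro summable_mult) (subst summable_Suc_iff)
  qed
  also have "\<dots> < \<infinity>" by simp
  finally show ?thesis .
qed

lemma (in prob_space) prob_ge_le_of_ennreal_powr_moment:
  assumes [measurable]: "T \<in> borel_measurable M"
    and moment: "(\<integral>\<^sup>+\<omega>. ennreal_powr (T \<omega>) p \<partial>M) \<le> ennreal c"
    and "0 < p" "0 \<le> c" "1 \<le> k"
  shows "prob {\<omega> \<in> space M. of_nat k \<le> T \<omega>} \<le> c * real k powr (- p)"
proof -
  define A where "A = {\<omega> \<in> space M. of_nat k \<le> T \<omega>}"
  have A[measurable]: "A \<in> sets M" unfolding A_def by measurable
  have "ennreal (real k powr p) * indicator A \<omega> \<le> ennreal_powr (T \<omega>) p" for \<omega>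
  proof (cases "\<omega> \<in> A \<and> T \<omega> \<noteq> \<infinity>")
    case True
    then have "real k \<le> enn2real (T \<omega>)"
      using enn2real_mono[of "of_nat k" "T \<omega>"] by (auto simp: A_def less_top)
    then have "real k powr p \<le> enn2real (T \<omega>) powr p"
      using \<open>0 < p\<close> by (intro powr_mono2) auto
    then show ?thesis using True by (auto simp: ennreal_powr_def intro!: ennreal_leI)
  qed (auto simp: ennreal_powr_def indicator_def)
  then have "(\<integral>\<^sup>+\<omega>. ennreal (real k powr p) * indicator A \<omega> \<partial>M) \<le> ennreal c"
    by (intro order_trans[OF nn_integral_mono moment]) auto
  then have "ennreal (real k powr p * prob A) \<le> ennreal c"
    by (simp add: nn_integral_cmult_indicator emeasure_eq_measure ennreal_mult)
  then have "real k powr p * prob A \<le> c" using \<open>0 \<le> c\<close> by simp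
  then show ?thesis using \<open>1 \<le> k\<close> unfolding A_def by (simp add: powr_minus field_simps)
qed

section \<open>The strong law with polynomial deviation frequency\<close>

theorem theorem7:
  fixes M :: "'a measure" and X :: "nat \<Rightarrow> 'a \<Rightarrow> real" and q :: nat
  assumes "prob_space M"
    and "iid_sequence M X"
    and "\<forall>i\<ge>1. centered M (X i)"
    and "q \<ge> 1"
    and "integrable M (\<lambda>\<omega>. \<bar>X 1 \<omega>\<bar> ^ (2 * q))"
  shows "(AE \<omega> in M. (\<lambda>n. sample_mean X n \<omega>) \<longlonglongrightarrow> 0) \<and>
    (\<forall>\<epsilon>>0. \<forall>p::real. 0 < p \<and> p < real q - 1 \<longrightarrow>
      (\<exists>K::real. K > 0 \<and>
        (\<integral>\<^sup>+\<omega>. ennreal_powr (deviation_count X \<epsilon> \<omega>) p \<partial>M) < ennreal (p * K) \<and>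
        (\<forall>k::nat. k \<ge> 1 \<longrightarrow>
          measure M {\<omega> \<in> space M. deviation_count X \<epsilon> \<omega> \<ge> of_nat k}
            \<le> p * K * real k powr (- p))))"
proof -
  interpret prob_space M by fact
  have indep: "indep_vars (\<lambda>_. borel) X {1..}"
    and distr: "\<And>i. i \<ge> 1 \<Longrightarrow> distr M borel (X i) = distr M borel (X 1)"
    using assms(2) unfolding iid_sequence_def by blast+
  have X[measurable]: "X i \<in> borel_measurable M" if "i \<ge> 1" for i
    using assms(3) that by (auto simp: centered_def)
  have X1: "integrable M (\<lambda>\<omega>. X 1 \<omega> ^ k)" if "k \<le> 2 * q" for k
  proof (rule Bochner_Integration.integrable_bound)
    show "integrable M (\<lambda>\<omega>. 1 + \<bar>X 1 \<omega>\<bar> ^ (2 * q))" using assms(5) by simp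
    have "\<bar>x\<bar> ^ k \<le> 1 + \<bar>x\<bar> ^ (2 * q)" for x :: real
      using power_increasing[OF that, of "\<bar>x\<bar>"] power_le_one[of "\<bar>x\<bar>" k]
      by (cases "\<bar>x\<bar> \<le> 1") (auto intro: add_increasing add_increasing2)
    then show "AE \<omega> in M. norm (X 1 \<omega> ^ k) \<le> norm (1 + \<bar>X 1 \<omega>\<bar> ^ (2 * q))"
      by (auto simp: power_abs)
  qed (use X[of 1] in measurable)
  have moments: "expectation (\<lambda>\<omega>. X i \<omega> ^ k) = expectation (\<lambda>\<omega>. X 1 \<omega> ^ k)"
    and int: "k \<le> 2 * q \<Longrightarrow> integrable M (\<lambda>\<omega>. X i \<omega> ^ k)" if i: "i \<in> {1..}" for i k
  proof -
    have i1: "i \<ge> 1" using i by simp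
    show "expectation (\<lambda>\<omega>. X i \<omega> ^ k) = expectation (\<lambda>\<omega>. X 1 \<omega> ^ k)"
      using integral_distr[OF X[OF i1], of "\<lambda>x. x ^ k"] integral_distr[OF X[of 1], of "\<lambda>x. x ^ k"]
      by (simp add: distr[OF i1])
    show "integrable M (\<lambda>\<omega>. X i \<omega> ^ k)" if "k \<le> 2 * q"
      using integrable_distr_eq[OF X[OF i1], of "\<lambda>x. x ^ k"]
        integrable_distr_eq[OF X[of 1], of "\<lambda>x. x ^ k"] X1[OF that]
      by (simp add: distr[OF i1])
  qed
  \<comment> \<open>The sum of all moments of order up to \<open>2q\<close> is a crude bound for each of them.\<close>
  define B where "B = (\<Sum>k\<le>2 * q. \<bar>expectation (\<lambda>\<omega>. X 1 \<omega> ^ k)\<bar>)"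
  have B0: "0 \<le> B" unfolding B_def by (intro sum_nonneg) auto
  have B: "\<bar>expectation (\<lambda>\<omega>. X i \<omega> ^ k)\<bar> \<le> B" if "i \<in> {1..}" "k \<le> 2 * q" for i k
    unfolding moments[OF that(1)] B_def using that by (intro member_le_sum) auto
  have mean: "expectation (X i) = 0" if "i \<in> {1..}" for i
    using assms(3) that by (simp add: centered_def)
  have bound: "\<exists>C\<ge>0. \<forall>I. finite I \<longrightarrow> I \<subseteq> {1..} \<longrightarrow>
      \<bar>expectation (\<lambda>\<omega>. (\<Sum>i\<in>I. X i \<omega>) ^ r)\<bar> \<le> C * real (card I) ^ (r div 2)"
    if "r \<le> 2 * q" for r
    by (rule moment_bound_indep_sum[where R = "2 * q" and B = B])
      (fact indep int mean B B0 that)+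
  have int_sum: "integrable M (\<lambda>\<omega>. (\<Sum>i\<in>I. X i \<omega>) ^ r)"
    if "finite I" "I \<subseteq> {1..}" "r \<le> 2 * q" for I r
    by (rule integrable_power_indep_sum[where R = "2 * q"]) (fact indep int that)+
  have two_le: "2 \<le> 2 * q" using assms(4) by simp
  have "AE \<omega> in M. (\<lambda>n. sample_mean X n \<omega>) \<longlonglongrightarrow> 0"
  proof -
    from bound[OF two_le] obtain C where "C \<ge> 0" and C: "\<forall>I. finite I \<longrightarrow> I \<subseteq> {1..} \<longrightarrow>
        \<bar>expectation (\<lambda>\<omega>. (\<Sum>i\<in>I. X i \<omega>)\<^sup>2)\<bar> \<le> C * real (card I) ^ (2 div 2)"
      by (elim exE conjE)
    show ?thesis
    proof (rule strong_law_of_quadratic_bound)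
      show "integrable M (\<lambda>\<omega>. (\<Sum>i\<in>I. X i \<omega>)\<^sup>2)" if "finite I" "I \<subseteq> {1..}" for I
        using that assms(4) by (intro int_sum) auto
      show "expectation (\<lambda>\<omega>. (\<Sum>i\<in>I. X i \<omega>)\<^sup>2) \<le> C * real (card I)"
        if "finite I" "I \<subseteq> {1..}" for I
        using C[rule_format, OF that] by simp
    qed fact
  qed
  moreover have "\<exists>K::real. K > 0 \<and>
        (\<integral>\<^sup>+\<omega>. ennreal_powr (deviation_count X \<epsilon> \<omega>) p \<partial>M) < ennreal (p * K) \<and>
        (\<forall>k::nat. k \<ge> 1 \<longrightarrow>
          measure M {\<omega> \<in> space M. deviation_count X \<epsilon> \<omega> \<ge> of_nat k}
            \<le> p * K * real k powr (- p))"
    if "\<epsilon> > 0" and p: "0 < p" "p < real q - 1" for \<epsilon> p :: real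
  proof -
    from bound[OF order_refl] obtain C where C: "\<forall>I. finite I \<longrightarrow> I \<subseteq> {1..} \<longrightarrow>
        \<bar>expectation (\<lambda>\<omega>. (\<Sum>i\<in>I. X i \<omega>) ^ (2 * q))\<bar> \<le> C * real (card I) ^ (2 * q div 2)"
      by (elim exE conjE)
    have meas: "sample_mean X n \<in> borel_measurable M" for n
      unfolding sample_mean_def by (intro borel_measurable_divide borel_measurable_sum) auto
    note meas[measurable]
    have tail: "prob {\<omega> \<in> space M. \<epsilon> \<le> \<bar>sample_mean X n \<omega>\<bar>} \<le> C / \<epsilon> ^ (2 * q) * real n powr (- real q)"
      if "n \<ge> 1" for n
      using C[rule_format, of "{1..n}"] that \<open>\<epsilon> > 0\<close>
      by (intro prob_large_sample_mean_le int_sum meas) auto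
    define E where "E = (\<integral>\<^sup>+\<omega>. ennreal_powr (deviation_count X \<epsilon> \<omega>) p \<partial>M)"
    have "E < \<infinity>" unfolding E_def
      by (rule nn_integral_deviation_count_powr_finite[OF meas tail p])
    then obtain e where e: "e \<ge> 0" "E = ennreal e" by (cases E) auto
    \<comment> \<open>The summand \<open>1\<close> makes the moment bound strict and \<open>K\<close> positive.\<close>
    define K where "K = (e + 1) / p"
    have K: "K > 0" "p * K = e + 1" using e p by (auto simp: K_def)
    have cnt: "deviation_count X \<epsilon> \<in> borel_measurable M"
      unfolding deviation_count_def indicator_def by measurable
    have "E < ennreal (p * K)" using e K by (simp add: ennreal_lessI)
    moreover have "prob {\<omega> \<in> space M. of_nat k \<le> deviation_count X \<epsilon> \<omega>} \<le> p * K * real k powr (- p)"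
      if "k \<ge> 1" for k
      using e K p that \<open>E < ennreal (p * K)\<close>
      by (intro prob_ge_le_of_ennreal_powr_moment[OF cnt]) (auto simp flip: E_def)
    ultimately show ?thesis using K unfolding E_def by blast
  qed
  ultimately show ?thesis by blast
qed

end
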